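(* Let $r_{ij}\ge 0$ for $1\le i<j\le n$, and let $X_{ij}\sim F_{ij}$, $1\le i<j\le n$, be independent random variables, where $F_{ij}$ is a distribution function with support on $[0,r_{ij}]$. For $1\le i<j\le n$ let $X_{ji}=r_{ij}-X_{ij}$. Set $S_i=\sum_{j=1,\,j\neq i}^{n}X_{ij}$, $i=1,\ldots,n$. Then $S_1,\ldots,S_n$ are negatively associated. More generally, if $S_i=u_i(X_{i1},\ldots,X_{i,i-1},X_{i,i+1},\ldots,X_{in})$, $i=1,\ldots,n$, where the $u_i:\mathbb{R}^{n-1}\to\mathbb{R}$ are any (coordinate-wise) increasing functions, then again $S_1,\ldots,S_n$ are negatively associated.
   Context: Throughout, increasing means nondecreasing. Random variables $S_1,\ldots,S_n$ are said to be negatively associated (NA) if for every pair of disjoint subsets $A_1, A_2$ of $\{1,\ldots,n\}$, $$\mathrm{Cov}\left(f_1(S_i, i\in A_1),\, f_2(S_j, j\in A_2)\right)\leq 0$$ whenever $f_1$ and $f_2$ are real-valued functions, increasing in all coordinates, for which the covariance exists. (Interpretation: in a constant-sum round-robin tournament, $X_{ij}$ is player $i$'s reward in the match against player $j$, and $S_i$ is player $i$'s total reward.) *)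

theory Defs
  imports "HOL-Probability.Probability"
begin

text \<open>
  A function on \<open>\<real>\<^sup>J\<close> (\<open>J\<close> a finite index set) is a function on the families in \<open>extensional J\<close>, the
  underlying space of \<open>PiM J (\<lambda>_. borel)\<close>; its values elsewhere are irrelevant.
  Increasing means nondecreasing.
\<close>

definition coordinatewise_increasing :: "'i set \<Rightarrow> (('i \<Rightarrow> real) \<Rightarrow> real) \<Rightarrow> bool" where
  "coordinatewise_increasing J f \<longleftrightarrow>
     (\<forall>x \<in> extensional J. \<forall>j \<in> J. mono (\<lambda>t. f (x(j := t))))"

definition covariance :: "'a measure \<Rightarrow> ('a \<Rightarrow> real) \<Rightarrow> ('a \<Rightarrow> real) \<Rightarrow> real" where
  "covariance M X Y =
     (LINT \<omega>|M. (X \<omega> - (LINT \<omega>'|M. X \<omega>')) * (Y \<omega> - (LINT \<omega>'|M. Y \<omega>')))"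

definition covariance_exists :: "'a measure \<Rightarrow> ('a \<Rightarrow> real) \<Rightarrow> ('a \<Rightarrow> real) \<Rightarrow> bool" where
  "covariance_exists M X Y \<longleftrightarrow>
     integrable M X \<and> integrable M Y \<and> integrable M (\<lambda>\<omega>. X \<omega> * Y \<omega>)"

text \<open>
  The test functions \<open>f\<^sub>1\<close>, \<open>f\<^sub>2\<close> are Borel, as is implicit whenever functions of random variables are
  formed.  This does not follow from monotonicity in two or more variables, and measurability
  of \<open>f\<^sub>1(S)\<close>, \<open>f\<^sub>2(S)\<close> with respect to \<open>M\<close> alone is not enough: \<open>M\<close> may be an extension of
  Lebesgue measure that correlates non-Borel functions of independent variables.
\<close>

definition negatively_associated :: "'a measure \<Rightarrow> 'i set \<Rightarrow> ('i \<Rightarrow> 'a \<Rightarrow> real) \<Rightarrow> bool" where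
  "negatively_associated M I S \<longleftrightarrow>
     (\<forall>i \<in> I. S i \<in> borel_measurable M) \<and>
     (\<forall>A1 A2 f1 f2.
        A1 \<subseteq> I \<longrightarrow> A2 \<subseteq> I \<longrightarrow> A1 \<inter> A2 = {} \<longrightarrow>
        f1 \<in> borel_measurable (PiM A1 (\<lambda>_. borel)) \<longrightarrow> coordinatewise_increasing A1 f1 \<longrightarrow>
        f2 \<in> borel_measurable (PiM A2 (\<lambda>_. borel)) \<longrightarrow> coordinatewise_increasing A2 f2 \<longrightarrow>
        covariance_exists M (\<lambda>\<omega>. f1 (\<lambda>i\<in>A1. S i \<omega>)) (\<lambda>\<omega>. f2 (\<lambda>i\<in>A2. S i \<omega>)) \<longrightarrow>
        covariance M (\<lambda>\<omega>. f1 (\<lambda>i\<in>A1. S i \<omega>)) (\<lambda>\<omega>. f2 (\<lambda>i\<in>A2. S i \<omega>)) \<le> 0)"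

text \<open>The law with distribution function \<open>F\<close> is concentrated on the interval from \<open>a\<close> to \<open>b\<close>.\<close>

definition df_supported_on :: "(real \<Rightarrow> real) \<Rightarrow> real \<Rightarrow> real \<Rightarrow> bool" where
  "df_supported_on F a b \<longleftrightarrow> (\<forall>t < a. F t = 0) \<and> (\<forall>t \<ge> b. F t = 1)"

end

theory Submission
  imports Defs
begin

text \<open>
  Each match reward \<open>X\<^sub>e\<close>, \<open>e = (i, j)\<close> with \<open>i < j\<close>, raises the score of \<open>i\<close>, lowers the score of \<open>j\<close>
  and leaves every other score alone.  Hence, if \<open>A\<^sub>1\<close> and \<open>A\<^sub>2\<close> are disjoint sets of players, then in each
  independent coordinate \<open>X\<^sub>e\<close> the functions \<open>f\<^sub>1(S\<^sub>i, i \<in> A\<^sub>1)\<close> and \<open>f\<^sub>2(S\<^sub>j, j \<in> A\<^sub>2)\<close> move in opposite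
  directions, or at least one of them does not depend on \<open>X\<^sub>e\<close>: a match between two members of
  \<open>A\<^sub>1\<close> may affect \<open>f\<^sub>1\<close> in any manner, but does not concern \<open>A\<^sub>2\<close> at all.  Both cases are captured by
  \<^term>\<open>(f (x(e := t)) - f (x(e := t'))) * (g (y(e := t)) - g (y(e := t'))) \<le> (0 :: real)\<close>
  for all \<open>x\<close>, \<open>y\<close>, \<open>t\<close>, \<open>t'\<close>.
  This condition survives integrating out the other coordinates, so induction on the
  number of coordinates, with Chebyshev's association inequality on the line at each step, gives
  \<open>E[f g] \<le> E f E g\<close> (\<open>product_covariance_nonpos\<close>).  This needs bounded functions; truncation and
  dominated convergence reach all test functions whose covariance exists
  (\<open>covariance_nonpos_of_truncations\<close>).

  The score functions \<open>u\<^sub>i\<close> are increasing but need not be Borel, so the Fubini argument does not apply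
  to them directly.  However, an increasing function agrees with a Borel function almost everywhere
  with respect to any product of probability measures (\<open>signed_increasing_AE_eq_borel\<close>): along the
  last coordinate an up-set is a ray, known up to its endpoint from countably many parallel sections,
  and it suffices that these sections include the ones at the atoms of the last factor.  The Borel
  version may violate monotonicity on a null set, which is why the covariance inequality is proved
  for pairs consisting of a function with the order property and an almost everywhere equal Borel version.
\<close>

section \<open>Splitting off one coordinate of a finite product\<close>

lemma measurable_fun_upd_pair:
  "(\<lambda>(t, x). x(k := t)) \<in> N k \<Otimes>\<^sub>M PiM J N \<rightarrow>\<^sub>M PiM (insert k J) N"
  unfolding split_beta by (rule measurable_fun_upd[where J=J]) auto

lemma AE_PiM_insertD:
  assumes "\<And>i. prob_space (N i)" and AE: "AE z in PiM (insert k J) N. P z"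
  shows "AE t in N k. AE x in PiM J N. P (x(k := t))"
proof -
  interpret product_prob_space N by (rule product_prob_spaceI) (rule assms)
  interpret J: prob_space "PiM J N" by (rule prob_space_PiM) (rule assms)
  interpret Q: pair_prob_space "N k" "PiM J N" ..
  have "AE z in distr (N k \<Otimes>\<^sub>M PiM J N) (PiM (insert k J) N) (\<lambda>(t, x). x(k := t)). P z"
    using AE by (subst distr_pair_PiM_eq_PiM) (auto intro: assms)
  from AE_distrD[OF measurable_fun_upd_pair this] show ?thesis
    using Q.AE_pair[of "\<lambda>z. P ((\<lambda>(t, x). x(k := t)) z)"] by simp
qed

text \<open>
  The event \<open>P\<close> may be nonmeasurable.  Therefore the null set is transported along the inverse
  \<open>z \<mapsto> (z k, z restricted to J)\<close> of the joining map, which needs only the direction of the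
  transport of null sets that holds for arbitrary events.
\<close>

lemma AE_PiM_insertI:
  assumes N: "\<And>i. prob_space (N i)" and "k \<notin> J"
    and AE: "AE z in N k \<Otimes>\<^sub>M PiM J N. P ((snd z)(k := fst z))"
  shows "AE z in PiM (insert k J) N. P z"
proof -
  let ?split = "\<lambda>z. (z k, restrict z J)" and ?join = "\<lambda>(t, x). x(k := t)"
  have split: "?split \<in> PiM (insert k J) N \<rightarrow>\<^sub>M N k \<Otimes>\<^sub>M PiM J N"
    by (intro measurable_Pair measurable_component_singleton measurable_restrict_subset) auto
  have "distr (PiM (insert k J) N) (N k \<Otimes>\<^sub>M PiM J N) ?split =
      distr (distr (N k \<Otimes>\<^sub>M PiM J N) (PiM (insert k J) N) ?join) (N k \<Otimes>\<^sub>M PiM J N) ?split"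
    by (subst distr_pair_PiM_eq_PiM) (auto intro: N)
  also have "\<dots> = distr (N k \<Otimes>\<^sub>M PiM J N) (N k \<Otimes>\<^sub>M PiM J N) (?split \<circ> ?join)"
    by (rule distr_distr[OF split measurable_fun_upd_pair])
  also have "\<dots> = distr (N k \<Otimes>\<^sub>M PiM J N) (N k \<Otimes>\<^sub>M PiM J N) (\<lambda>z. z)"
    by (rule distr_cong)
       (use \<open>k \<notin> J\<close> in \<open>auto simp: space_pair_measure space_PiM PiE_def extensional_def restrict_def fun_eq_iff\<close>)
  also have "\<dots> = N k \<Otimes>\<^sub>M PiM J N"
    by (rule distr_id)
  finally have law: "distr (PiM (insert k J) N) (N k \<Otimes>\<^sub>M PiM J N) ?split = N k \<Otimes>\<^sub>M PiM J N" .
  have "AE z in distr (PiM (insert k J) N) (N k \<Otimes>\<^sub>M PiM J N) ?split. P ((snd z)(k := fst z))"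
    unfolding law by (rule AE)
  from AE_distrD[OF split this] show ?thesis
  proof (rule AE_mp, intro AE_I2 impI)
    fix z assume "z \<in> space (PiM (insert k J) N)"
    hence "(restrict z J)(k := z k) = z"
      by (auto simp: space_PiM PiE_def extensional_def restrict_def fun_eq_iff)
    thus "P ((snd (?split z))(k := fst (?split z))) \<Longrightarrow> P z" by simp
  qed
qed

section \<open>Monotone functions are measurable up to null sets\<close>

text \<open>
  The number \<open>s j\<close> records the direction of \<open>v\<close> in coordinate \<open>j\<close>: increasing if positive, decreasing if
  negative.  If it is \<open>0\<close>, then the hypothesis holds for \<open>t\<close>, \<open>t'\<close> in either order, so \<open>v\<close> does not
  depend on coordinate \<open>j\<close>.
\<close>

definition signed_increasing :: "('i \<Rightarrow> real) \<Rightarrow> 'i set \<Rightarrow> (('i \<Rightarrow> real) \<Rightarrow> real) \<Rightarrow> bool" where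
  "signed_increasing s J v \<longleftrightarrow>
     (\<forall>x \<in> extensional J. \<forall>j \<in> J. \<forall>t t'. s j * t \<le> s j * t' \<longrightarrow> v (x(j := t)) \<le> v (x(j := t')))"

text \<open>
  Let \<open>C\<close> be the rationals together with the atoms of the law of coordinate \<open>k\<close>.  The sections of \<open>U\<close>
  at the points of \<open>C\<close> are Borel up to null sets by induction.  They enclose \<open>U\<close> between a union \<open>L\<close>
  (some \<open>c \<in> C\<close> before \<open>t\<close> has \<open>x\<close> in its section) and an intersection \<open>V\<close> (all \<open>c \<in> C\<close> after
  \<open>t\<close> do), where before and after follow the sign of \<open>s k\<close>.  For fixed \<open>x\<close>, the values \<open>t\<close>
  in \<open>V\<close> but not in \<open>L\<close> can have no rational number between them, nor lie in \<open>C\<close>, so there is at most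
  one and it is not an atom.  Hence \<open>L\<close> and \<open>V\<close> differ by a null set and \<open>U\<close> is almost everywhere
  equal to \<open>L\<close>.
\<close>

lemma signed_upset_AE_eq_borel:
  fixes N :: "'i \<Rightarrow> real measure" and s :: "'i \<Rightarrow> real"
  assumes "finite J" and N: "\<And>i. prob_space (N i)" "\<And>i. sets (N i) = sets borel"
    and "\<And>x j t t'. x \<in> extensional J \<Longrightarrow> j \<in> J \<Longrightarrow> s j * t \<le> s j * t' \<Longrightarrow>
           x(j := t) \<in> U \<Longrightarrow> x(j := t') \<in> U"
  shows "\<exists>B \<in> sets (PiM J N). AE x in PiM J N. x \<in> U \<longleftrightarrow> x \<in> B"
  using assms
proof (induction J arbitrary: U rule: finite_induct)
  case empty
  show ?case
    by (intro bexI[of _ "U \<inter> {\<lambda>_. undefined}"]) (auto simp: PiM_empty AE_count_space)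
next
  case (insert k J)
  interpret k: prob_space "N k" by (rule N)
  note up = insert.prems(3)
  interpret product_prob_space N by (rule product_prob_spaceI) (rule N)
  interpret J: prob_space "PiM J N" by (rule prob_space_PiM) (rule N)
  interpret Q: pair_prob_space "PiM J N" "N k" ..
  interpret Q': pair_prob_space "N k" "PiM J N" ..
  define C where "C = \<rat> \<union> {t. measure (N k) {t} \<noteq> 0}"
  have C: "countable C"
    unfolding C_def using countable_rat k.countable_support by blast
  have "\<exists>B \<in> sets (PiM J N). AE x in PiM J N. x \<in> {x. x(k := c) \<in> U} \<longleftrightarrow> x \<in> B" for c
  proof (rule insert.IH[OF N])
    fix x j t t' assume x: "x \<in> extensional J" "j \<in> J" "s j * t \<le> s j * t'" "x(j := t) \<in> {x. x(k := c) \<in> U}"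
    have "j \<noteq> k" using x insert.hyps by auto
    moreover have "x(k := c) \<in> extensional (insert k J)" using x by (auto simp: extensional_def)
    ultimately show "x(j := t') \<in> {x. x(k := c) \<in> U}"
      using up[of "x(k := c)" j t t'] x by (simp add: fun_upd_twist[of j k] del: fun_upd_apply)
  qed
  hence "\<forall>c. \<exists>B. B \<in> sets (PiM J N) \<and> (AE x in PiM J N. x(k := c) \<in> U \<longleftrightarrow> x \<in> B)"
    unfolding mem_Collect_eq Bex_def by (rule allI)
  from choice[OF this] obtain B
    where "\<forall>c. B c \<in> sets (PiM J N) \<and> (AE x in PiM J N. x(k := c) \<in> U \<longleftrightarrow> x \<in> B c)"
    by (elim exE)
  hence B: "\<And>c. B c \<in> sets (PiM J N)"
      and BU: "\<And>c. AE x in PiM J N. x(k := c) \<in> U \<longleftrightarrow> x \<in> B c" by auto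
  define L where "L x t \<longleftrightarrow> (\<exists>c\<in>C. s k * c \<le> s k * t \<and> x \<in> B c)" for x t
  define V where "V x t \<longleftrightarrow> (\<forall>c\<in>C. s k * t \<le> s k * c \<longrightarrow> x \<in> B c)" for x t
  have [measurable]: "(\<lambda>t. t) \<in> borel_measurable (N k)"
    by (simp add: measurable_def N(2) sets_eq_imp_space_eq[OF N(2)])
  note [measurable] = B
  \<comment> \<open>Stated for every \<open>x\<close>: this concerns the Borel sets \<open>B c\<close> alone, whether or not they agree with
     the sections of \<open>U\<close> at \<open>x\<close>.\<close>
  have gap: "AE t in N k. \<not> (V x t \<and> \<not> L x t)" for x
  proof (cases "\<exists>t. V x t \<and> \<not> L x t")
    case True
    then obtain u where u: "V x u" "\<not> L x u" by auto
    have unique: False if "V x t" "\<not> L x t" "V x t'" "\<not> L x t'" "t < t'" for t t'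
    proof -
      obtain q where q: "q \<in> \<rat>" "t < q" "q < t'" using Rats_dense_in_real[OF \<open>t < t'\<close>] by auto
      have qC: "q \<in> C" using q by (simp add: C_def)
      show False
      proof (cases "0 \<le> s k")
        case True
        with q have "s k * t \<le> s k * q" "s k * q \<le> s k * t'" by (auto intro: mult_left_mono)
        with that qC show False unfolding L_def V_def by blast
      next
        case False
        with q have "s k * t' \<le> s k * q" "s k * q \<le> s k * t" by (auto intro: mult_left_mono_neg)
        with that qC show False unfolding L_def V_def by blast
      qed
    qed
    have "u \<notin> C" using u unfolding L_def V_def by blast
    hence "emeasure (N k) {u} = 0" by (auto simp: C_def k.emeasure_eq_measure)
    hence "AE t in N k. t \<notin> {u}" by (intro AE_not_in) (auto simp: null_sets_def N)
    thus ?thesis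
      by (rule AE_mp) (intro AE_I2 impI notI, metis u unique linorder_neqE singletonI)
  qed auto
  \<comment> \<open>\<open>V\<close> and \<open>L\<close> are Borel, so the order of the two quantifiers may be exchanged; for \<open>U\<close>
     itself this would not be legitimate.\<close>
  have "AE t in N k. AE x in PiM J N. \<not> (V x t \<and> \<not> L x t)"
    by (subst Q.AE_commute[symmetric])
       (use gap C in \<open>auto simp: L_def V_def\<close>)
  hence "AE z in N k \<Otimes>\<^sub>M PiM J N. \<not> (V (snd z) (fst z) \<and> \<not> L (snd z) (fst z))"
    by (intro Q'.AE_pair_measure) (use C in \<open>auto simp: L_def V_def\<close>)
  moreover have "AE z in N k \<Otimes>\<^sub>M PiM J N. \<forall>c\<in>C. (snd z)(k := c) \<in> U \<longleftrightarrow> snd z \<in> B c"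
  proof -
    have "AE x in PiM J N. \<forall>c\<in>C. x(k := c) \<in> U \<longleftrightarrow> x \<in> B c"
      using BU by (simp add: AE_ball_countable[OF C])
    then obtain Z where Z: "{x \<in> space (PiM J N). \<not> (\<forall>c\<in>C. x(k := c) \<in> U \<longleftrightarrow> x \<in> B c)} \<subseteq> Z"
        "Z \<in> null_sets (PiM J N)"
      unfolding eventually_ae_filter by blast
    note [measurable] = null_setsD2[OF Z(2)]
    have "AE z in N k \<Otimes>\<^sub>M PiM J N. snd z \<notin> Z"
      by (rule Q'.AE_pair_measure) (use AE_not_in[OF Z(2)] in auto)
    thus ?thesis
    proof (rule AE_mp, intro AE_I2 impI)
      fix z assume "z \<in> space (N k \<Otimes>\<^sub>M PiM J N)" "snd z \<notin> Z"
      moreover from this have "snd z \<in> space (PiM J N)" by (auto simp: space_pair_measure)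
      ultimately show "\<forall>c\<in>C. (snd z)(k := c) \<in> U \<longleftrightarrow> snd z \<in> B c"
        using Z(1) by blast
    qed
  qed
  ultimately have main: "AE z in N k \<Otimes>\<^sub>M PiM J N.
      ((snd z)(k := fst z) \<in> U \<longleftrightarrow> L (snd z) (fst z))" 
  proof (rule AE_mp[OF AE_conjI], intro AE_I2 impI)
    fix z assume z: "z \<in> space (N k \<Otimes>\<^sub>M PiM J N)"
      and *: "\<not> (V (snd z) (fst z) \<and> \<not> L (snd z) (fst z)) \<and>
        (\<forall>c\<in>C. (snd z)(k := c) \<in> U \<longleftrightarrow> snd z \<in> B c)"
    obtain t x where [simp]: "z = (t, x)" by (cases z)
    have "x(k := undefined) \<in> extensional (insert k J)"
      using z by (auto simp: space_pair_measure space_PiM PiE_def extensional_def)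
    from up[OF this, of k] have mono: "x(k := b) \<in> U"
      if "s k * a \<le> s k * b" "x(k := a) \<in> U" for a b
      using that by (simp del: fun_upd_apply)
    show "((snd z)(k := fst z) \<in> U \<longleftrightarrow> L (snd z) (fst z))"
      using * mono unfolding L_def V_def by (simp del: fun_upd_apply, blast)
  qed
  define B' where "B' = {z \<in> space (PiM (insert k J) N). L (restrict z J) (z k)}"
  have B': "B' \<in> sets (PiM (insert k J) N)"
    unfolding B'_def L_def using C by measurable
  have "AE z in PiM (insert k J) N. z \<in> U \<longleftrightarrow> z \<in> B'"
  proof (rule AE_PiM_insertI[OF N(1) insert.hyps(2)], rule AE_mp[OF main], intro AE_I2 impI)
    fix z assume z: "z \<in> space (N k \<Otimes>\<^sub>M PiM J N)"
      and *: "(snd z)(k := fst z) \<in> U \<longleftrightarrow> L (snd z) (fst z)"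
    have "(snd z)(k := fst z) \<in> space (PiM (insert k J) N)"
      using measurable_space[OF measurable_fun_upd_pair z] unfolding split_beta .
    moreover have "restrict ((snd z)(k := fst z)) J = snd z"
      using z insert.hyps(2)
      by (auto simp: space_pair_measure space_PiM PiE_def extensional_def restrict_def fun_eq_iff)
    ultimately show "(snd z)(k := fst z) \<in> U \<longleftrightarrow> (snd z)(k := fst z) \<in> B'"
      using * by (simp add: B'_def del: fun_upd_apply) simp
  qed
  with B' show ?case by blast
qed

text \<open>
  Every level set of \<open>v\<close> is an up-set in the sense of the signs \<open>s\<close>, hence differs from a Borel set by a
  subset of a null set and belongs to the completed product \<open>\<sigma>\<close>-algebra.
\<close>

lemma signed_increasing_AE_eq_borel:
  fixes N :: "'i \<Rightarrow> real measure" and v :: "('i \<Rightarrow> real) \<Rightarrow> real"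
  assumes "finite J" "\<And>i. prob_space (N i)" "\<And>i. sets (N i) = sets borel"
    and v: "signed_increasing s J v"
  shows "\<exists>v' \<in> borel_measurable (PiM J N). AE x in PiM J N. v x = v' x"
proof (rule completion_ex_borel_measurable_real, unfold borel_measurable_iff_greater, intro allI)
  fix a
  have "\<exists>B \<in> sets (PiM J N). AE x in PiM J N. x \<in> {x. a < v x} \<longleftrightarrow> x \<in> B"
  proof (rule signed_upset_AE_eq_borel[OF assms(1-3)])
    fix x j t t' assume "x \<in> extensional J" "j \<in> J" "s j * t \<le> s j * t'" "x(j := t) \<in> {x. a < v x}"
    thus "x(j := t') \<in> {x. a < v x}"
      using v unfolding signed_increasing_def mem_Collect_eq by (meson less_le_trans)
  qed
  then obtain B where B: "B \<in> sets (PiM J N)" and ae: "AE x in PiM J N. a < v x \<longleftrightarrow> x \<in> B"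
    by auto
  define D where "D = {x \<in> space (PiM J N). (a < v x) \<noteq> (x \<in> B)}"
  have "Measurable.pred (completion (PiM J N)) (\<lambda>x. (a < v x) \<noteq> (x \<in> B))"
    by (rule sets_completion_AE) (use ae in simp)
  hence D: "D \<in> sets (completion (PiM J N))"
    by (simp add: D_def pred_def)
  have "{x \<in> space (completion (PiM J N)). a < v x} = (B - D) \<union> (D - B)"
    using sets.sets_into_space[OF B] by (auto simp: D_def)
  thus "{x \<in> space (completion (PiM J N)). a < v x} \<in> sets (completion (PiM J N))"
    using B D by auto
qed

section \<open>The covariance inequality on a product space\<close>

text \<open>
  The two base points \<open>x\<close> and \<open>y\<close> are independent of each other; this lets the condition pass to partial
  integrals of \<open>f\<close> and \<open>g\<close>, whose increments average over \<open>x\<close> and \<open>y\<close> separately.  It holds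
  if \<open>f\<close> and \<open>g\<close> are monotone in opposite directions, and also if one of them does
  not depend on the coordinate and the other depends on it arbitrarily.
\<close>

definition oppositely_varying :: "'i set \<Rightarrow> (('i \<Rightarrow> real) \<Rightarrow> real) \<Rightarrow> (('i \<Rightarrow> real) \<Rightarrow> real) \<Rightarrow> bool" where
  "oppositely_varying J f g \<longleftrightarrow>
     (\<forall>x \<in> extensional J. \<forall>y \<in> extensional J. \<forall>j \<in> J. \<forall>t t'.
        (f (x(j := t)) - f (x(j := t'))) * (g (y(j := t)) - g (y(j := t'))) \<le> 0)"

lemma integral_nonpos_AE:
  fixes f :: "'a \<Rightarrow> real"
  shows "AE x in M. f x \<le> 0 \<Longrightarrow> (LINT x|M. f x) \<le> 0"
  using integral_nonneg_AE[of "\<lambda>x. - f x" M] by simp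

text \<open>
  Chebyshev's association inequality: integrate the hypothesis over two independent copies \<open>t\<close>, \<open>t'\<close>.
  The exceptional set is allowed because partial integrals of almost everywhere equal versions
  satisfy the order relation only for almost all arguments.
\<close>

lemma chebyshev_AE:
  fixes F G :: "'a \<Rightarrow> real"
  assumes "prob_space P"
    and [measurable]: "F \<in> borel_measurable P" "G \<in> borel_measurable P"
    and bF: "\<And>t. \<bar>F t\<bar> \<le> K" and bG: "\<And>t. \<bar>G t\<bar> \<le> K"
    and D: "AE t in P. D t"
    and opp: "\<And>t t'. D t \<Longrightarrow> D t' \<Longrightarrow> (F t - F t') * (G t - G t') \<le> 0"
  shows "(LINT t|P. F t * G t) \<le> (LINT t|P. F t) * (LINT t|P. G t)"
proof -
  interpret prob_space P by fact
  have bFG: "\<bar>F t * G t\<bar> \<le> K * K" for t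
    unfolding abs_mult by (intro mult_mono bF bG) (use bF[of t] in auto)
  have [simp]: "integrable P F" "integrable P G" "integrable P (\<lambda>t. F t * G t)"
    by (intro integrable_const_bound[where B=K] integrable_const_bound[where B="K*K"];
        use bF bG bFG in simp)+
  let ?F = "LINT t|P. F t" and ?G = "LINT t|P. G t" and ?FG = "LINT t|P. F t * G t"
  have "?FG - F t' * ?G - G t' * ?F + F t' * G t' \<le> 0" if "D t'" for t'
  proof -
    have "(LINT t|P. F t * G t - F t' * G t - G t' * F t + F t' * G t') \<le> 0"
      by (rule integral_nonpos_AE, rule AE_mp[OF D], rule AE_I2)
         (use opp[OF _ that] in \<open>auto simp: algebra_simps\<close>)
    thus ?thesis by (simp add: prob_space)
  qed
  hence "AE t' in P. ?FG - F t' * ?G - G t' * ?F + F t' * G t' \<le> 0"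
    using D by (auto elim: AE_mp)
  hence "(LINT t'|P. ?FG - F t' * ?G - G t' * ?F + F t' * G t') \<le> 0"
    by (rule integral_nonpos_AE)
  thus ?thesis by (simp add: prob_space algebra_simps)
qed

text \<open>
  Here \<open>f\<close> and \<open>g\<close> carry the order property and \<open>f'\<close>, \<open>g'\<close> are Borel versions of them.  With \<open>F t\<close> and
  \<open>G t\<close> the partial integrals of \<open>f'\<close> and \<open>g'\<close> over all coordinates but \<open>k\<close>, the induction
  hypothesis bounds the partial integral of \<open>f' g'\<close> by \<open>F t * G t\<close>, and Chebyshev's inequality applies to
  \<open>F\<close> and \<open>G\<close>.  Both steps work at those \<open>t\<close> (predicate \<open>D\<close>) whose sections of \<open>f\<close>, \<open>f'\<close> and of
  \<open>g\<close>, \<open>g'\<close> agree almost everywhere.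
\<close>

lemma product_covariance_nonpos:
  fixes N :: "'i \<Rightarrow> real measure" and f g f' g' :: "('i \<Rightarrow> real) \<Rightarrow> real"
  assumes "finite J" and N: "\<And>i. prob_space (N i)" "\<And>i. sets (N i) = sets borel"
    and opp: "oppositely_varying J f g"
    and "f' \<in> borel_measurable (PiM J N)" "g' \<in> borel_measurable (PiM J N)"
    and bf: "\<And>x. \<bar>f' x\<bar> \<le> K" and bg: "\<And>x. \<bar>g' x\<bar> \<le> K"
    and "AE x in PiM J N. f x = f' x" "AE x in PiM J N. g x = g' x"
  shows "(LINT x|PiM J N. f' x * g' x) \<le> (LINT x|PiM J N. f' x) * (LINT x|PiM J N. g' x)"
  using assms
proof (induction J arbitrary: f g f' g' rule: finite_induct)
  case empty
  interpret product_prob_space N by (rule product_prob_spaceI) (rule N)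
  show ?case by (simp add: PiM_empty lebesgue_integral_count_space_finite)
next
  case (insert k J)
  interpret k: prob_space "N k" by (rule N)
  interpret product_prob_space N by (rule product_prob_spaceI) (rule N)
  interpret J: prob_space "PiM J N" by (rule prob_space_PiM) (rule N)
  interpret K: prob_space "PiM (insert k J) N" by (rule prob_space_PiM) (rule N)
  interpret Q: pair_prob_space "N k" "PiM J N" ..
  have Kpos: "0 \<le> K" using insert.prems(6)[of undefined] by linarith
  have upd: "(\<lambda>x. x(k := t)) \<in> PiM J N \<rightarrow>\<^sub>M PiM (insert k J) N" for t
    by (rule measurable_fun_upd[where J=J]) (auto simp: measurable_def sets_eq_imp_space_eq[OF N(2)])
  have sect: "(\<lambda>x. h (x(k := t))) \<in> borel_measurable (PiM J N)"
    if "h \<in> borel_measurable (PiM (insert k J) N)" for h :: "_ \<Rightarrow> real" and t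
    using measurable_compose[OF upd that] .
  have joint: "(\<lambda>(t, x). h (x(k := t))) \<in> borel_measurable (N k \<Otimes>\<^sub>M PiM J N)"
    if "h \<in> borel_measurable (PiM (insert k J) N)" for h :: "_ \<Rightarrow> real"
    using measurable_compose[OF measurable_fun_upd_pair that] unfolding split_beta .
  have fubini: "(LINT x|PiM (insert k J) N. h x) = (LINT t|N k. LINT x|PiM J N. h (x(k := t)))"
    if h: "h \<in> borel_measurable (PiM (insert k J) N)" and b: "\<And>x. \<bar>h x\<bar> \<le> B"
    for h :: "_ \<Rightarrow> real" and B
  proof -
    have "(LINT x|PiM (insert k J) N. h x) =
        (LINT x|distr (N k \<Otimes>\<^sub>M PiM J N) (PiM (insert k J) N) (\<lambda>(t, x). x(k := t)). h x)"
      by (subst distr_pair_PiM_eq_PiM) (auto intro: N)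
    also have "\<dots> = (LINT z|(N k \<Otimes>\<^sub>M PiM J N). (\<lambda>(t, x). h (x(k := t))) z)"
      by (subst integral_distr[OF measurable_fun_upd_pair h], rule Bochner_Integration.integral_cong) auto
    also have "\<dots> = (LINT t|N k. LINT x|PiM J N. h (x(k := t)))"
      by (subst Q.integral_fst'[symmetric])
         (auto intro!: Q.integrable_const_bound[where B=B] joint h b)
    finally show ?thesis .
  qed
  define F G where "F t = (LINT x|PiM J N. f' (x(k := t)))"
    and "G t = (LINT x|PiM J N. g' (x(k := t)))" for t
  have [measurable]: "F \<in> borel_measurable (N k)" "G \<in> borel_measurable (N k)"
    unfolding F_def G_def by (rule J.borel_measurable_lebesgue_integral, rule joint, rule insert.prems)+
  have bound: "\<bar>LINT x|PiM J N. h (x(k := t))\<bar> \<le> K"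
    if "h \<in> borel_measurable (PiM (insert k J) N)" "\<And>x. \<bar>h x\<bar> \<le> K" for h :: "_ \<Rightarrow> real" and t
  proof -
    have "\<bar>LINT x|PiM J N. h (x(k := t))\<bar> \<le> (LINT x|PiM J N. \<bar>h (x(k := t))\<bar>)"
      by (rule integral_abs_bound)
    also have "\<dots> \<le> K"
      by (rule J.integral_le_const)
         (auto intro!: integrable_abs J.integrable_const_bound[where B=K] sect that)
    finally show ?thesis .
  qed
  have bFG: "\<bar>F t\<bar> \<le> K" "\<bar>G t\<bar> \<le> K" for t
    unfolding F_def G_def by (intro bound insert.prems)+
  define D where "D t \<longleftrightarrow> (AE x in PiM J N. f (x(k := t)) = f' (x(k := t))) \<and>
      (AE x in PiM J N. g (x(k := t)) = g' (x(k := t)))" for t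
  have D_f: "AE x in PiM J N. f (x(k := t)) = f' (x(k := t))"
    and D_g: "AE x in PiM J N. g (x(k := t)) = g' (x(k := t))" if "D t" for t
    using that unfolding D_def by (rule conjunct1, rule conjunct2)
  have D: "AE t in N k. D t"
    unfolding D_def
    using AE_PiM_insertD[OF N(1) insert.prems(8)] AE_PiM_insertD[OF N(1) insert.prems(9)]
    by (rule AE_conjI)
  have bprod: "\<bar>f' x * g' x\<bar> \<le> K * K" for x
    unfolding abs_mult by (intro mult_mono insert.prems Kpos) auto
  have mprod: "(\<lambda>x. f' x * g' x) \<in> borel_measurable (PiM (insert k J) N)"
    using insert.prems(4,5) by simp
  have IH: "(LINT x|PiM J N. f' (x(k := t)) * g' (x(k := t))) \<le> F t * G t" if "D t" for t
    unfolding F_def G_def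
  proof (rule insert.IH[OF N])
    show "oppositely_varying J (\<lambda>x. f (x(k := t))) (\<lambda>x. g (x(k := t)))"
      unfolding oppositely_varying_def
    proof (intro ballI allI)
      fix x y :: "'i \<Rightarrow> real" and j a b assume "x \<in> extensional J" "y \<in> extensional J" "j \<in> J"
      moreover have "j \<noteq> k" using \<open>j \<in> J\<close> insert.hyps by auto
      moreover have "x(k := t) \<in> extensional (insert k J)" "y(k := t) \<in> extensional (insert k J)"
        using calculation by (auto simp: extensional_def)
      ultimately show "(f (x(j := a, k := t)) - f (x(j := b, k := t))) *
          (g (y(j := a, k := t)) - g (y(j := b, k := t))) \<le> 0"
        using insert.prems(3)[unfolded oppositely_varying_def, rule_format, of "x(k := t)" "y(k := t)" j a b]
        by (simp add: fun_upd_twist[of j k] del: fun_upd_apply)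
    qed
  qed (use D_f[OF that] D_g[OF that] insert.prems in \<open>auto intro!: sect simp del: fun_upd_apply\<close>)
  have opp1: "(F t - F t') * (G t - G t') \<le> 0" if t: "D t" and t': "D t'" for t t'
  proof -
    let ?a = "\<lambda>x. f' (x(k := t)) - f' (x(k := t'))" and ?b = "\<lambda>y. g' (y(k := t)) - g' (y(k := t'))"
    have int [simp]: "integrable (PiM J N) (\<lambda>x. f' (x(k := t)))" "integrable (PiM J N) (\<lambda>x. g' (x(k := t)))" for t
      by (auto intro!: J.integrable_const_bound[where B=K] sect insert.prems)
    have a: "AE x in PiM J N. ?a x = f (x(k := t)) - f (x(k := t'))"
      using D_f[OF t] D_f[OF t'] by eventually_elim simp
    have b: "AE x in PiM J N. ?b x = g (x(k := t)) - g (x(k := t'))"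
      using D_g[OF t] D_g[OF t'] by eventually_elim simp
    have step: "(LINT x|PiM J N. ?a x) * ?b y \<le> 0"
      if y: "y \<in> space (PiM J N)" "?b y = g (y(k := t)) - g (y(k := t'))"
      for y :: "'i \<Rightarrow> real"
    proof -
      have "AE x in PiM J N. ?a x * ?b y \<le> 0"
        using a
      proof (rule AE_mp, intro AE_I2 impI)
        fix x assume x: "x \<in> space (PiM J N)" "?a x = f (x(k := t)) - f (x(k := t'))"
        have "x(k := undefined) \<in> extensional (insert k J)" "y(k := undefined) \<in> extensional (insert k J)"
          using x y by (auto simp: space_PiM PiE_def extensional_def)
        \<comment> \<open>The value \<open>undefined\<close> at \<open>k\<close> is overwritten; \<open>x\<close> and \<open>y\<close> must only be seen as families
           indexed by \<open>insert k J\<close>.\<close>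
        hence "(f (x(k := undefined, k := t)) - f (x(k := undefined, k := t'))) *
          (g (y(k := undefined, k := t)) - g (y(k := undefined, k := t'))) \<le> 0"
          using insert.prems(3) unfolding oppositely_varying_def by blast
        thus "?a x * ?b y \<le> 0" using x y by simp
      qed
      hence "(LINT x|PiM J N. ?a x * ?b y) \<le> 0" by (rule integral_nonpos_AE)
      thus ?thesis by simp
    qed
    have "(LINT y|PiM J N. (LINT x|PiM J N. ?a x) * ?b y) \<le> 0"
      using b by (intro integral_nonpos_AE) (elim AE_mp, intro AE_I2 impI step, auto)
    moreover have "(LINT x|PiM J N. ?a x) = F t - F t'" "(LINT x|PiM J N. ?b x) = G t - G t'"
      unfolding F_def G_def by simp_all
    ultimately show ?thesis by simp
  qed
  have "(LINT x|PiM (insert k J) N. f' x * g' x) =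
      (LINT t|N k. LINT x|PiM J N. f' (x(k := t)) * g' (x(k := t)))"
    by (rule fubini[OF mprod bprod])
  also have "\<dots> \<le> (LINT t|N k. F t * G t)"
  proof (rule integral_mono_AE)
    have "\<bar>LINT x|PiM J N. f' (x(k := t)) * g' (x(k := t))\<bar> \<le> K * K" for t
    proof -
      have "\<bar>LINT x|PiM J N. f' (x(k := t)) * g' (x(k := t))\<bar> \<le> (LINT x|PiM J N. \<bar>f' (x(k := t)) * g' (x(k := t))\<bar>)"
        by (rule integral_abs_bound)
      also have "\<dots> \<le> K * K"
        by (rule J.integral_le_const)
           (auto intro!: integrable_abs J.integrable_const_bound[where B="K*K"] sect[OF mprod] bprod simp del: abs_mult)
      finally show ?thesis .
    qed
    moreover have "(\<lambda>t. LINT x|PiM J N. f' (x(k := t)) * g' (x(k := t))) \<in> borel_measurable (N k)"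
      by (rule J.borel_measurable_lebesgue_integral, rule joint, rule mprod)
    ultimately show "integrable (N k) (\<lambda>t. LINT x|PiM J N. f' (x(k := t)) * g' (x(k := t)))"
      by (intro k.integrable_const_bound[where B="K*K"]) auto
    have "\<bar>F t * G t\<bar> \<le> K * K" for t
      unfolding abs_mult by (intro mult_mono bFG Kpos) auto
    thus "integrable (N k) (\<lambda>t. F t * G t)"
      by (intro k.integrable_const_bound[where B="K*K"]) auto
    show "AE t in N k. (LINT x|PiM J N. f' (x(k := t)) * g' (x(k := t))) \<le> F t * G t"
      using D by (elim AE_mp) (intro AE_I2 impI IH)
  qed
  also have "\<dots> \<le> (LINT t|N k. F t) * (LINT t|N k. G t)"
    by (rule chebyshev_AE[OF N(1) _ _ bFG D opp1]) auto
  also have "\<dots> = (LINT x|PiM (insert k J) N. f' x) * (LINT x|PiM (insert k J) N. g' x)"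
    unfolding F_def G_def by (simp only: fubini[OF insert.prems(4,6)] fubini[OF insert.prems(5,7)])
  finally show ?case .
qed

section \<open>Increasing functions of families with opposite signs\<close>

lemma coordinatewise_increasing_le:
  assumes f: "coordinatewise_increasing A f" and "finite A"
    and x: "x \<in> extensional A" and y: "y \<in> extensional A" and le: "\<And>i. i \<in> A \<Longrightarrow> x i \<le> y i"
  shows "f x \<le> f y"
proof -
  have "f x \<le> f (\<lambda>i. if i \<in> B then y i else x i)" if "B \<subseteq> A" for B
    using finite_subset[OF that \<open>finite A\<close>] that
  proof (induction B rule: finite_induct)
    case (insert b B)
    let ?z = "\<lambda>i. if i \<in> B then y i else x i"
    have "?z \<in> extensional A" using x y by (auto simp: extensional_def)
    hence "mono (\<lambda>t. f (?z(b := t)))"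
      using f insert.prems unfolding coordinatewise_increasing_def by blast
    hence "f (?z(b := x b)) \<le> f (?z(b := y b))"
      using le insert.prems by (auto dest: monoD)
    moreover have "?z(b := x b) = ?z" "?z(b := y b) = (\<lambda>i. if i \<in> insert b B then y i else x i)"
      using insert.hyps by auto
    ultimately show ?case using insert by simp
  qed simp
  moreover have "(\<lambda>i. if i \<in> A then y i else x i) = y"
    using x y by (auto simp: extensional_def)
  ultimately show ?thesis by (metis subset_refl)
qed

text \<open>
  Changing coordinate \<open>e\<close> from \<open>t\<close> to \<open>t'\<close> moves each \<open>v i\<close> in the direction of \<open>s i e * (t' - t)\<close>.  An
  index of \<open>A1\<close> and an index of \<open>A2\<close> never move strictly the same way.  So one of the families moves weakly
  up as a whole, and one of them (the same or the other) moves weakly down.  If it is the same, the function of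
  that family does not change; otherwise the two functions move oppositely.
\<close>

lemma oppositely_varying_compose:
  fixes v :: "'i \<Rightarrow> ('e \<Rightarrow> real) \<Rightarrow> real" and s :: "'i \<Rightarrow> 'e \<Rightarrow> real"
  assumes fin: "finite A1" "finite A2" and disj: "A1 \<inter> A2 = {}"
    and h1: "coordinatewise_increasing A1 h1" and h2: "coordinatewise_increasing A2 h2"
    and v: "\<And>i. i \<in> A1 \<union> A2 \<Longrightarrow> signed_increasing (s i) E (v i)"
    and s: "\<And>i j e. i \<in> A1 \<Longrightarrow> j \<in> A2 \<Longrightarrow> e \<in> E \<Longrightarrow> s i e * s j e \<le> 0"
  shows "oppositely_varying E (\<lambda>x. h1 (\<lambda>i\<in>A1. v i x)) (\<lambda>x. h2 (\<lambda>i\<in>A2. v i x))"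
  unfolding oppositely_varying_def
proof (intro ballI allI)
  fix x y :: "'e \<Rightarrow> real" and e t t'
  assume x: "x \<in> extensional E" and y: "y \<in> extensional E" and e: "e \<in> E"
  have step: "h (\<lambda>i\<in>A. v i (z(e := a))) \<le> h (\<lambda>i\<in>A. v i (z(e := b)))"
    if "coordinatewise_increasing A h" "finite A" "A \<subseteq> A1 \<union> A2" "z \<in> extensional E"
       "\<forall>i\<in>A. s i e * a \<le> s i e * b" for A h z a b
    using that v e
    by (intro coordinatewise_increasing_le[OF that(1,2)]) (auto simp: signed_increasing_def)
  let ?up = "\<lambda>A. \<forall>i\<in>A. s i e * t \<le> s i e * t'" and ?down = "\<lambda>A. \<forall>i\<in>A. s i e * t' \<le> s i e * t"
  have one: "?up A1 \<or> ?up A2" and two: "?down A1 \<or> ?down A2"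
  proof -
    have prod: "(s i e * t' - s i e * t) * (s j e * t' - s j e * t) \<le> 0" if "i \<in> A1" "j \<in> A2" for i j
    proof -
      have "(s i e * t' - s i e * t) * (s j e * t' - s j e * t) = (s i e * s j e) * (t' - t)\<^sup>2"
        by (simp add: algebra_simps power2_eq_square)
      thus ?thesis using s[OF that e] by (simp add: mult_nonpos_nonneg)
    qed
    show "?up A1 \<or> ?up A2"
      using prod by (meson diff_less_0_iff_less mult_neg_neg not_le)
    show "?down A1 \<or> ?down A2"
      using prod by (meson diff_gt_0_iff_gt mult_pos_pos not_le)
  qed
  let ?f = "\<lambda>t. h1 (\<lambda>i\<in>A1. v i (x(e := t)))" and ?g = "\<lambda>t. h2 (\<lambda>i\<in>A2. v i (y(e := t)))"
  have "?up A1 \<Longrightarrow> ?f t \<le> ?f t'" "?down A1 \<Longrightarrow> ?f t' \<le> ?f t"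
    by (rule step[OF h1 fin(1) _ x]; auto)+
  moreover have "?up A2 \<Longrightarrow> ?g t \<le> ?g t'" "?down A2 \<Longrightarrow> ?g t' \<le> ?g t"
    by (rule step[OF h2 fin(2) _ y]; auto)+
  ultimately have "(?f t \<le> ?f t' \<or> ?g t \<le> ?g t') \<and> (?f t' \<le> ?f t \<or> ?g t' \<le> ?g t)"
    using one two by blast
  thus "(?f t - ?f t') * (?g t - ?g t') \<le> 0"
    by (auto simp: mult_le_0_iff)
qed

section \<open>From bounded to integrable test functions\<close>

definition truncate :: "real \<Rightarrow> real \<Rightarrow> real" where
  "truncate K z = max (- K) (min K z)"

lemma truncate_mono: "a \<le> b \<Longrightarrow> truncate K a \<le> truncate K b"
  unfolding truncate_def by linarith

lemma abs_truncate_le: "0 \<le> K \<Longrightarrow> \<bar>truncate K z\<bar> \<le> K" "0 \<le> K \<Longrightarrow> \<bar>truncate K z\<bar> \<le> \<bar>z\<bar>"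
  unfolding truncate_def by linarith+

lemma measurable_truncate [measurable]: "truncate K \<in> borel_measurable borel"
  unfolding truncate_def by measurable

lemma truncate_tendsto: "(\<lambda>n. truncate (real n) z) \<longlonglongrightarrow> z"
proof (rule tendsto_eventually)
  show "\<forall>\<^sub>F n in sequentially. truncate (real n) z = z"
    using eventually_ge_at_top[of "nat \<lceil>\<bar>z\<bar>\<rceil>"]
  proof eventually_elim
    case (elim n)
    hence "\<bar>z\<bar> \<le> real n" by linarith
    thus ?case unfolding truncate_def by linarith
  qed
qed

text \<open>
  Truncation at \<open>n\<close> does not increase absolute values, so \<open>\<bar>X\<bar>\<close>, \<open>\<bar>Y\<bar>\<close> and \<open>\<bar>X Y\<bar>\<close> dominate the three
  integrands; existence of the covariance is what makes these majorants integrable.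
\<close>

lemma (in prob_space) covariance_nonpos_of_truncations:
  assumes ex: "covariance_exists M X Y"
    and trunc: "\<And>n. expectation (\<lambda>\<omega>. truncate (real n) (X \<omega>) * truncate (real n) (Y \<omega>)) \<le>
      expectation (\<lambda>\<omega>. truncate (real n) (X \<omega>)) * expectation (\<lambda>\<omega>. truncate (real n) (Y \<omega>))"
  shows "covariance M X Y \<le> 0"
proof -
  have int [simp]: "integrable M X" "integrable M Y" "integrable M (\<lambda>\<omega>. X \<omega> * Y \<omega>)"
    using ex by (auto simp: covariance_exists_def)
  note [measurable] = int[THEN borel_measurable_integrable]
  have lim: "(\<lambda>n. expectation (\<lambda>\<omega>. truncate (real n) (Z \<omega>))) \<longlonglongrightarrow> expectation Z"
    if "integrable M Z" for Z
  proof (rule integral_dominated_convergence[where w="\<lambda>\<omega>. \<bar>Z \<omega>\<bar>"])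
    show "Z \<in> borel_measurable M" using that by auto
    thus "(\<lambda>\<omega>. truncate (real n) (Z \<omega>)) \<in> borel_measurable M" for n by measurable
  qed (use that in \<open>auto intro!: truncate_tendsto AE_I2 abs_truncate_le(2)\<close>)
  have "(\<lambda>n. expectation (\<lambda>\<omega>. truncate (real n) (X \<omega>) * truncate (real n) (Y \<omega>)))
      \<longlonglongrightarrow> expectation (\<lambda>\<omega>. X \<omega> * Y \<omega>)"
  proof (rule integral_dominated_convergence[where w="\<lambda>\<omega>. \<bar>X \<omega> * Y \<omega>\<bar>"])
    show "AE \<omega> in M. norm (truncate (real n) (X \<omega>) * truncate (real n) (Y \<omega>)) \<le> \<bar>X \<omega> * Y \<omega>\<bar>" for n
      by (auto simp: abs_mult intro!: mult_mono abs_truncate_le)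
  qed (auto intro!: tendsto_mult truncate_tendsto)
  from LIMSEQ_le[OF this tendsto_mult[OF lim[OF int(1)] lim[OF int(2)]]]
  have "expectation (\<lambda>\<omega>. X \<omega> * Y \<omega>) \<le> expectation X * expectation Y"
    using trunc by blast
  moreover have "covariance M X Y = expectation (\<lambda>\<omega>. X \<omega> * Y \<omega>) - expectation X * expectation Y"
    unfolding covariance_def by (simp add: algebra_simps prob_space)
  ultimately show ?thesis by simp
qed

section \<open>Negative association\<close>

lemma (in prob_space) distr_indep_vars_eq_PiM:
  fixes Y :: "'e \<Rightarrow> 'a \<Rightarrow> real"
  assumes "finite E" and indep: "indep_vars (\<lambda>_. borel) Y E"
  shows "distr M (PiM E (\<lambda>_. borel)) (\<lambda>\<omega>. \<lambda>e\<in>E. Y e \<omega>) = PiM E (\<lambda>e. distr M borel (Y e))"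
proof (cases "E = {}")
  case True
  have "distr M (count_space {\<lambda>_ :: 'e. undefined :: real}) (\<lambda>\<omega>. \<lambda>_. undefined) = count_space {\<lambda>_. undefined :: real}"
    by (rule measure_eqI_countable[of _ "{\<lambda>_. undefined}"]) (auto simp: emeasure_distr emeasure_space_1)
  thus ?thesis unfolding True PiM_empty restrict_def by simp
next
  case False
  thus ?thesis
    using indep_vars_iff_distr_eq_PiM'[of E Y "\<lambda>_. borel"] indep
    by (auto simp: indep_vars_def)
qed

text \<open>
  The sign condition says that each independent input is favourable to at most one index and unfavourable to
  at most one.  In a tournament these are the two players of a match.
\<close>

lemma (in prob_space) negatively_associated_of_opposite_signs:
  fixes Y :: "'e \<Rightarrow> 'a \<Rightarrow> real" and v :: "'i \<Rightarrow> ('e \<Rightarrow> real) \<Rightarrow> real" and s :: "'i \<Rightarrow> 'e \<Rightarrow> real"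
  assumes E: "finite E" and I: "finite I" and indep: "indep_vars (\<lambda>_. borel) Y E"
    and v: "\<And>i. i \<in> I \<Longrightarrow> signed_increasing (s i) E (v i)"
    and s: "\<And>i j e. i \<in> I \<Longrightarrow> j \<in> I \<Longrightarrow> i \<noteq> j \<Longrightarrow> e \<in> E \<Longrightarrow> s i e * s j e \<le> 0"
    and S: "\<And>i. i \<in> I \<Longrightarrow> S i \<in> borel_measurable M"
    and Sv: "\<And>i \<omega>. i \<in> I \<Longrightarrow> \<omega> \<in> space M \<Longrightarrow> S i \<omega> = v i (\<lambda>e\<in>E. Y e \<omega>)"
  shows "negatively_associated M I S"
proof -
  \<comment> \<open>Outside \<open>E\<close> the factor is an arbitrary probability measure, so that \<open>N\<close> is a
     family of probability measures indexed by the whole type.\<close>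
  define N where "N e = distr M borel (if e \<in> E then Y e else (\<lambda>_. 0))" for e
  have Y: "Y e \<in> borel_measurable M" if "e \<in> E" for e
    using indep that by (auto simp: indep_vars_def)
  have N: "prob_space (N e)" "sets (N e) = sets borel" for e
    unfolding N_def by (auto intro!: prob_space_distr prob_space_return Y)
  let ?Y = "\<lambda>\<omega>. \<lambda>e\<in>E. Y e \<omega>"
  have Ymeas: "?Y \<in> M \<rightarrow>\<^sub>M PiM E N"
    by (rule measurable_restrict) (use Y in \<open>simp add: measurable_cong_sets[OF refl N(2)]\<close>)
  have "distr M (PiM E N) ?Y = distr M (PiM E (\<lambda>_. borel)) ?Y"
    by (intro distr_cong sets_PiM_cong) (auto simp: N)
  also have "\<dots> = PiM E N"
    unfolding distr_indep_vars_eq_PiM[OF E indep] by (intro PiM_cong) (auto simp: N_def)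
  finally have law: "distr M (PiM E N) ?Y = PiM E N" .
  have "\<forall>i\<in>I. \<exists>v'. v' \<in> borel_measurable (PiM E N) \<and> (AE x in PiM E N. v i x = v' x)"
    using signed_increasing_AE_eq_borel[where N=N, OF E N v] by blast
  from bchoice[OF this] obtain v' where v': "\<And>i. i \<in> I \<Longrightarrow> v' i \<in> borel_measurable (PiM E N)"
      and vv': "\<And>i. i \<in> I \<Longrightarrow> AE x in PiM E N. v i x = v' i x"
    by blast
  have bounded: "expectation (\<lambda>\<omega>. h1 (\<lambda>i\<in>A1. S i \<omega>) * h2 (\<lambda>i\<in>A2. S i \<omega>)) \<le>
      expectation (\<lambda>\<omega>. h1 (\<lambda>i\<in>A1. S i \<omega>)) * expectation (\<lambda>\<omega>. h2 (\<lambda>i\<in>A2. S i \<omega>))"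
    if A: "A1 \<subseteq> I" "A2 \<subseteq> I" "A1 \<inter> A2 = {}"
      and h: "h1 \<in> borel_measurable (PiM A1 (\<lambda>_. borel))" "coordinatewise_increasing A1 h1"
        "h2 \<in> borel_measurable (PiM A2 (\<lambda>_. borel))" "coordinatewise_increasing A2 h2"
      and K: "\<And>z. \<bar>h1 z\<bar> \<le> K" "\<And>z. \<bar>h2 z\<bar> \<le> K" for A1 A2 h1 h2 K
  proof -
    let ?f = "\<lambda>x. h1 (\<lambda>i\<in>A1. v i x)" and ?g = "\<lambda>x. h2 (\<lambda>i\<in>A2. v i x)"
    let ?f' = "\<lambda>x. h1 (\<lambda>i\<in>A1. v' i x)" and ?g' = "\<lambda>x. h2 (\<lambda>i\<in>A2. v' i x)"
    have fin: "finite A1" "finite A2" using finite_subset[OF A(1) I] finite_subset[OF A(2) I] by auto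
    have meas: "(\<lambda>x. h (\<lambda>i\<in>A. v' i x)) \<in> borel_measurable (PiM E N)"
      if "A \<subseteq> I" "h \<in> borel_measurable (PiM A (\<lambda>_. borel))" for A and h :: "('i \<Rightarrow> real) \<Rightarrow> real"
      by (rule measurable_compose[OF measurable_restrict that(2)]) (use v' that(1) in auto)
    have ae: "AE x in PiM E N. h (\<lambda>i\<in>A. v i x) = h (\<lambda>i\<in>A. v' i x)"
      if "A \<subseteq> I" for A and h :: "('i \<Rightarrow> real) \<Rightarrow> real"
    proof -
      have "AE x in PiM E N. \<forall>i\<in>A. v i x = v' i x"
        by (rule AE_finite_allI) (use that I finite_subset vv' in auto)
      thus ?thesis by eventually_elim (simp cong: restrict_cong)
    qed
    have prod: "(LINT x|PiM E N. ?f' x * ?g' x) \<le> (LINT x|PiM E N. ?f' x) * (LINT x|PiM E N. ?g' x)"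
      by (rule product_covariance_nonpos[where N=N, OF E N _ meas[OF A(1) h(1)] meas[OF A(2) h(3)] K ae[OF A(1)] ae[OF A(2)]],
          rule oppositely_varying_compose[OF fin A(3) h(2,4)])
         (use v s A in blast)+
    have transfer: "expectation X = (LINT x|PiM E N. \<phi> x)"
      if "\<phi> \<in> borel_measurable (PiM E N)" "AE \<omega> in M. X \<omega> = \<phi> (?Y \<omega>)" "X \<in> borel_measurable M"
      for X and \<phi> :: "_ \<Rightarrow> real"
    proof -
      have "expectation X = expectation (\<lambda>\<omega>. \<phi> (?Y \<omega>))"
        by (rule integral_cong_AE[OF that(3) measurable_compose[OF Ymeas that(1)] that(2)])
      also have "\<dots> = (LINT x|distr M (PiM E N) ?Y. \<phi> x)"
        by (rule integral_distr[OF Ymeas that(1), symmetric])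
      finally show ?thesis unfolding law .
    qed
    have measS: "(\<lambda>\<omega>. h (\<lambda>i\<in>A. S i \<omega>)) \<in> borel_measurable M"
      if "A \<subseteq> I" "h \<in> borel_measurable (PiM A (\<lambda>_. borel))" for A and h :: "('i \<Rightarrow> real) \<Rightarrow> real"
      by (rule measurable_compose[OF measurable_restrict that(2)]) (use S that(1) in auto)
    have aeS: "AE \<omega> in M. h (\<lambda>i\<in>A. S i \<omega>) = h (\<lambda>i\<in>A. v' i (?Y \<omega>))"
      if "A \<subseteq> I" for A and h :: "('i \<Rightarrow> real) \<Rightarrow> real"
    proof -
      have "AE x in distr M (PiM E N) ?Y. h (\<lambda>i\<in>A. v i x) = h (\<lambda>i\<in>A. v' i x)"
        unfolding law by (rule ae[OF that])
      from AE_distrD[OF Ymeas this] show ?thesis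
      proof (rule AE_mp, intro AE_I2 impI)
        fix \<omega> assume "\<omega> \<in> space M"
        hence "(\<lambda>i\<in>A. S i \<omega>) = (\<lambda>i\<in>A. v i (?Y \<omega>))"
          using that Sv by (intro restrict_ext) auto
        thus "h (\<lambda>i\<in>A. v i (?Y \<omega>)) = h (\<lambda>i\<in>A. v' i (?Y \<omega>)) \<Longrightarrow>
            h (\<lambda>i\<in>A. S i \<omega>) = h (\<lambda>i\<in>A. v' i (?Y \<omega>))" by simp
      qed
    qed
    have "expectation (\<lambda>\<omega>. h1 (\<lambda>i\<in>A1. S i \<omega>) * h2 (\<lambda>i\<in>A2. S i \<omega>)) = (LINT x|PiM E N. ?f' x * ?g' x)"
    proof (rule transfer)
      show "AE \<omega> in M. h1 (\<lambda>i\<in>A1. S i \<omega>) * h2 (\<lambda>i\<in>A2. S i \<omega>) = ?f' (?Y \<omega>) * ?g' (?Y \<omega>)"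
        using aeS[OF A(1), of h1] aeS[OF A(2), of h2] by eventually_elim simp
    qed (intro borel_measurable_times meas measS A h)+
    moreover have "expectation (\<lambda>\<omega>. h1 (\<lambda>i\<in>A1. S i \<omega>)) = (LINT x|PiM E N. ?f' x)"
      by (rule transfer) (intro meas measS aeS A h)+
    moreover have "expectation (\<lambda>\<omega>. h2 (\<lambda>i\<in>A2. S i \<omega>)) = (LINT x|PiM E N. ?g' x)"
      by (rule transfer) (intro meas measS aeS A h)+
    ultimately show ?thesis using prod by simp
  qed
  show ?thesis
    unfolding negatively_associated_def
  proof (intro conjI ballI allI impI S)
    fix A1 A2 f1 f2
    assume A: "A1 \<subseteq> I" "A2 \<subseteq> I" "A1 \<inter> A2 = {}"
      and f1: "f1 \<in> borel_measurable (PiM A1 (\<lambda>_. borel))" "coordinatewise_increasing A1 f1"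
      and f2: "f2 \<in> borel_measurable (PiM A2 (\<lambda>_. borel))" "coordinatewise_increasing A2 f2"
      and ex: "covariance_exists M (\<lambda>\<omega>. f1 (\<lambda>i\<in>A1. S i \<omega>)) (\<lambda>\<omega>. f2 (\<lambda>i\<in>A2. S i \<omega>))"
    have tr: "coordinatewise_increasing A (\<lambda>z. truncate (real n) (f z))"
      if "coordinatewise_increasing A f" for A f n
      using that truncate_mono unfolding coordinatewise_increasing_def mono_def by blast
    show "covariance M (\<lambda>\<omega>. f1 (\<lambda>i\<in>A1. S i \<omega>)) (\<lambda>\<omega>. f2 (\<lambda>i\<in>A2. S i \<omega>)) \<le> 0"
    proof (rule covariance_nonpos_of_truncations[OF ex])
      fix n :: nat
      show "expectation (\<lambda>\<omega>. truncate (real n) (f1 (\<lambda>i\<in>A1. S i \<omega>)) * truncate (real n) (f2 (\<lambda>i\<in>A2. S i \<omega>)))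
        \<le> expectation (\<lambda>\<omega>. truncate (real n) (f1 (\<lambda>i\<in>A1. S i \<omega>))) *
          expectation (\<lambda>\<omega>. truncate (real n) (f2 (\<lambda>i\<in>A2. S i \<omega>)))"
      proof (rule bounded[OF A])
        show "\<bar>truncate (real n) (f1 z)\<bar> \<le> real n" "\<bar>truncate (real n) (f2 z)\<bar> \<le> real n" for z
          by (simp_all add: abs_truncate_le)
      qed (intro tr f1 f2 measurable_compose[OF _ measurable_truncate])+
    qed
  qed
qed

theorem proposition2p1:
  fixes M :: "'a measure" and n :: nat
    and r :: "nat \<Rightarrow> nat \<Rightarrow> real"
    and F :: "nat \<Rightarrow> nat \<Rightarrow> real \<Rightarrow> real"
    and X :: "nat \<Rightarrow> nat \<Rightarrow> 'a \<Rightarrow> real"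
  assumes "prob_space M"
    and "\<And>i j. 1 \<le> i \<Longrightarrow> i < j \<Longrightarrow> j \<le> n \<Longrightarrow> 0 \<le> r i j"
    and "\<And>i j. 1 \<le> i \<Longrightarrow> i < j \<Longrightarrow> j \<le> n \<Longrightarrow> df_supported_on (F i j) 0 (r i j)"
    and "\<And>i j. 1 \<le> i \<Longrightarrow> i < j \<Longrightarrow> j \<le> n \<Longrightarrow> cdf (distr M borel (X i j)) = F i j"
    and "prob_space.indep_vars M (\<lambda>_. borel) (\<lambda>(i, j). X i j) {(i, j). 1 \<le> i \<and> i < j \<and> j \<le> n}"
    and "\<And>i j \<omega>. 1 \<le> i \<Longrightarrow> i < j \<Longrightarrow> j \<le> n \<Longrightarrow> \<omega> \<in> space M \<Longrightarrow> X j i \<omega> = r i j - X i j \<omega>"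
  shows "negatively_associated M {1..n} (\<lambda>i \<omega>. \<Sum>j\<in>{1..n} - {i}. X i j \<omega>) \<and>
         (\<forall>u :: nat \<Rightarrow> (nat \<Rightarrow> real) \<Rightarrow> real.
           (\<forall>i\<in>{1..n}. coordinatewise_increasing ({1..n} - {i}) (u i)) \<longrightarrow>
           (\<forall>i\<in>{1..n}. (\<lambda>\<omega>. u i (\<lambda>j\<in>{1..n} - {i}. X i j \<omega>)) \<in> borel_measurable M) \<longrightarrow>
           negatively_associated M {1..n} (\<lambda>i \<omega>. u i (\<lambda>j\<in>{1..n} - {i}. X i j \<omega>)))"
proof
  interpret prob_space M by fact
  define E where "E = {(i, j). 1 \<le> i \<and> i < j \<and> j \<le> n}"
  have "finite E"
    by (rule finite_subset[of _ "{1..n} \<times> {1..n}"]) (auto simp: E_def)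
  \<comment> \<open>A match \<open>(i, j)\<close> with \<open>i < j\<close> counts for \<open>i\<close> through \<open>X i j\<close> and for \<open>j\<close> through
     \<open>X j i = r i j - X i j\<close>.\<close>
  define s :: "nat \<Rightarrow> nat \<times> nat \<Rightarrow> real"
    where "s i e = (if fst e = i then 1 else if snd e = i then - 1 else 0)" for i e
  define row :: "nat \<Rightarrow> (nat \<times> nat \<Rightarrow> real) \<Rightarrow> nat \<Rightarrow> real"
    where "row i x = (\<lambda>j\<in>{1..n} - {i}. if i < j then x (i, j) else r j i - x (j, i))" for i x
  have row_X: "(\<lambda>j\<in>{1..n} - {i}. X i j \<omega>) = row i (\<lambda>e\<in>E. (\<lambda>(i, j). X i j) e \<omega>)"
    if "i \<in> {1..n}" "\<omega> \<in> space M" for i \<omega>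
    unfolding row_def
  proof (rule restrict_ext)
    fix j assume "j \<in> {1..n} - {i}"
    thus "X i j \<omega> = (if i < j then (\<lambda>e\<in>E. (\<lambda>(i, j). X i j) e \<omega>) (i, j)
        else r j i - (\<lambda>e\<in>E. (\<lambda>(i, j). X i j) e \<omega>) (j, i))"
      using that assms(6)[of j i \<omega>] by (auto simp: E_def)
  qed
  show general: "\<forall>u :: nat \<Rightarrow> (nat \<Rightarrow> real) \<Rightarrow> real.
      (\<forall>i\<in>{1..n}. coordinatewise_increasing ({1..n} - {i}) (u i)) \<longrightarrow>
      (\<forall>i\<in>{1..n}. (\<lambda>\<omega>. u i (\<lambda>j\<in>{1..n} - {i}. X i j \<omega>)) \<in> borel_measurable M) \<longrightarrow>
      negatively_associated M {1..n} (\<lambda>i \<omega>. u i (\<lambda>j\<in>{1..n} - {i}. X i j \<omega>))"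
  proof (intro allI impI)
    fix u :: "nat \<Rightarrow> (nat \<Rightarrow> real) \<Rightarrow> real"
    assume u: "\<forall>i\<in>{1..n}. coordinatewise_increasing ({1..n} - {i}) (u i)"
      and meas: "\<forall>i\<in>{1..n}. (\<lambda>\<omega>. u i (\<lambda>j\<in>{1..n} - {i}. X i j \<omega>)) \<in> borel_measurable M"
    show "negatively_associated M {1..n} (\<lambda>i \<omega>. u i (\<lambda>j\<in>{1..n} - {i}. X i j \<omega>))"
    proof (rule negatively_associated_of_opposite_signs[OF \<open>finite E\<close>])
      show "indep_vars (\<lambda>_. borel) (\<lambda>(i, j). X i j) E"
        unfolding E_def by (rule assms(5))
      show "signed_increasing (s i) E (\<lambda>x. u i (row i x))" if i: "i \<in> {1..n}" for i
        unfolding signed_increasing_def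
      proof (intro ballI allI impI)
        fix x :: "nat \<times> nat \<Rightarrow> real" and e t t'
        assume "e \<in> E" and le: "s i e * t \<le> s i e * t'"
        then obtain a b where e: "e = (a, b)" "1 \<le> a" "a < b" "b \<le> n" by (auto simp: E_def)
        have mono: "mono (\<lambda>t. u i ((row i x)(j := t)))" if "j \<in> {1..n} - {i}" for j
          using u i that unfolding coordinatewise_increasing_def by (auto simp: row_def)
        consider "a = i" | "b = i" | "a \<noteq> i" "b \<noteq> i" by blast
        thus "u i (row i (x(e := t))) \<le> u i (row i (x(e := t')))"
        proof cases
          case 1
          hence "row i (x(e := t)) = (row i x)(b := t)" for t
            using e by (auto simp: row_def fun_eq_iff)
          thus ?thesis using mono[of b] le 1 e by (auto simp: s_def dest: monoD)
        next
          case 2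
          hence "row i (x(e := t)) = (row i x)(a := r a i - t)" for t
            using e by (auto simp: row_def fun_eq_iff)
          thus ?thesis using monoD[OF mono[of a], of "r a i - t" "r a i - t'"] le 2 e by (auto simp: s_def)
        next
          case 3
          hence "row i (x(e := t)) = row i x" for t
            using e by (auto simp: row_def fun_eq_iff)
          thus ?thesis by simp
        qed
      qed
      show "s i e * s j e \<le> 0" if "i \<noteq> j" for i j e
        using that by (auto simp: s_def)
    qed (use meas row_X in auto)
  qed
  let ?total = "\<lambda>i z. \<Sum>j\<in>{1..n} - {i}. z j :: real"
  have X_upper: "X i j \<in> borel_measurable M" if "1 \<le> i" "i < j" "j \<le> n" for i j
    using assms(5) that unfolding indep_vars_def by auto
  have X_meas: "X i j \<in> borel_measurable M" if "i \<in> {1..n}" "j \<in> {1..n} - {i}" for i j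
  proof (cases "i < j")
    case False
    hence ji: "1 \<le> j" "j < i" "i \<le> n" using that by auto
    have "(\<lambda>\<omega>. r j i - X j i \<omega>) \<in> borel_measurable M" using X_upper[OF ji] by simp
    thus ?thesis using assms(6)[OF ji] by (simp cong: measurable_cong)
  qed (use X_upper that in auto)
  have sum_restrict: "?total i (\<lambda>j\<in>{1..n} - {i}. X i j \<omega>) = (\<Sum>j\<in>{1..n} - {i}. X i j \<omega>)" for i \<omega>
    by (intro sum.cong) auto
  have "coordinatewise_increasing ({1..n} - {i}) (?total i)" for i
    unfolding coordinatewise_increasing_def by (auto intro!: monoI sum_mono split: if_splits)
  moreover have "(\<lambda>\<omega>. \<Sum>j\<in>{1..n} - {i}. X i j \<omega>) \<in> borel_measurable M" if "i \<in> {1..n}" for i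
    using X_meas[OF that] by (intro borel_measurable_sum)
  ultimately show "negatively_associated M {1..n} (\<lambda>i \<omega>. \<Sum>j\<in>{1..n} - {i}. X i j \<omega>)"
    using general[rule_format, of ?total] unfolding sum_restrict by blast
qed

end
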